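(* Let $s\ge1$ be an integer. For every ordered real node set $0=c_0<c_1<\cdots<c_s=1$, the $2s+2$ polynomials $$\Pi_0,\ldots,\Pi_s,\quad z\Pi_0,\ldots,z\Pi_s$$ form a basis of $\mathbb P_{2s+1}$, where $\Pi_j(z)$ is the Taylor truncation at degree $2s$ of $Q_s(z)e^{c_jz}$, $j=0,\ldots,s$.
   Context: $\mathbb P_N$ denotes the vector space of real polynomials in $z$ of degree at most $N$. Taylor truncation at degree $N$ of $f(z)=\sum_{m\ge0}f_mz^m$ is $\sum_{m=0}^Nf_mz^m$. $Q_s$ is the denominator, normalized by $Q_s(0)=1$, of the Padé approximant $[s-1/s+1]_{e^z}=P_s/Q_s$ of the exponential (i.e. $\deg P_s\le s-1$, $\deg Q_s\le s+1$, $Q_s(z)e^z-P_s(z)=\mathcal O(z^{2s+1})$ as $z\to0$); explicitly $$Q_s(z)=\sum_{k=0}^{s+1}\frac{(2s-k)!\,(s+1)!}{(2s)!\,k!\,(s+1-k)!}(-z)^k.$$ *)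

theory Defs
  imports "HOL-Analysis.Analysis" "HOL-Library.Landau_Symbols"
    "HOL-Computational_Algebra.Polynomial_FPS"
begin

global_interpretation poly_vs: vector_space "smult :: real \<Rightarrow> real poly \<Rightarrow> real poly"
  by unfold_locales (simp_all add: smult_add_left smult_add_right)

definition polys_upto :: "nat \<Rightarrow> real poly set"
  where "polys_upto N = {p. degree p \<le> N}"

definition taylor_truncation :: "nat \<Rightarrow> real fps \<Rightarrow> real poly"
  where "taylor_truncation N f = (\<Sum>m\<le>N. monom (fps_nth f m) m)"

definition is_pade :: "nat \<Rightarrow> nat \<Rightarrow> (real \<Rightarrow> real) \<Rightarrow> real poly \<Rightarrow> real poly \<Rightarrow> bool"
  where "is_pade l m f P Q \<longleftrightarrow>
    degree P \<le> l \<and> degree Q \<le> m \<and> poly Q 0 = 1 \<and>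
    (\<lambda>z. poly Q z * f z - poly P z) \<in> O[at 0](\<lambda>z. z ^ (l + m + 1))"

text \<open>The description is meaningful for \<open>s \<ge> 1\<close>: existence and uniqueness, together with the
  explicit formula, are established in \<open>pade_denom_exp_eq\<close> at the end of this theory.\<close>

definition pade_denom_exp :: "nat \<Rightarrow> real poly"
  where "pade_denom_exp s = (THE Q. \<exists>P. is_pade (s - 1) (s + 1) exp P Q)"

text \<open>The truncation of \<open>Q\<^sub>s(z) e\<^sup>x\<^sup>z\<close>; \<open>\<Pi>\<^sub>j\<close> is its value at the node \<open>x = c\<^sub>j\<close>.\<close>

definition Pi_poly :: "nat \<Rightarrow> real \<Rightarrow> real poly"
  where "Pi_poly s x = taylor_truncation (2 * s) (fps_of_poly (pade_denom_exp s) * fps_exp x)"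


subsection \<open>Order of vanishing and power series coefficients\<close>

lemma has_fps_expansion_poly: "poly p has_fps_expansion fps_of_poly (p :: real poly)"
proof (induction p)
  case 0
  then show ?case by (simp add: poly_0)
next
  case (pCons a p)
  have "(\<lambda>x. a + x * poly p x) has_fps_expansion (fps_const a + fps_X * fps_of_poly p)"
    by (intro fps_expansion_intros pCons)
  then show ?case by (simp add: fps_of_poly_pCons mult.commute)
qed

lemma fps_expansion_factor:
  fixes f :: "real \<Rightarrow> real"
  assumes f: "f has_fps_expansion F" and z: "\<forall>m<n. fps_nth F m = 0"
  obtains g where "isCont g 0" "g 0 = fps_nth F n" "eventually (\<lambda>z. f z = z ^ n * g z) (nhds 0)"
proof -
  define G where "G = fps_shift n F"
  have FG: "F = fps_X ^ n * G"
    by (rule fps_ext) (use z in \<open>auto simp: G_def fps_X_power_mult_nth\<close>)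
  have rF: "fps_conv_radius F > 0" and ev: "eventually (\<lambda>z. eval_fps F z = f z) (nhds 0)"
    using f by (auto simp: has_fps_expansion_def)
  have rG: "fps_conv_radius G > 0" using rF by (simp add: G_def)
  have gexp: "eval_fps G has_fps_expansion G" using rG by (rule eval_fps_has_fps_expansion)
  have "isCont (eval_fps G) 0" using gexp by (rule has_fps_expansion_imp_continuous)
  moreover have "eval_fps G 0 = fps_nth F n" by (simp add: eval_fps_at_0 G_def)
  moreover have "(\<lambda>z. z ^ n * eval_fps G z) has_fps_expansion F"
    unfolding FG by (intro fps_expansion_intros gexp)
  then have "eventually (\<lambda>z. eval_fps F z = z ^ n * eval_fps G z) (nhds 0)"
    by (auto simp: has_fps_expansion_def)
  with ev have "eventually (\<lambda>z. f z = z ^ n * eval_fps G z) (nhds 0)"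
    by eventually_elim simp
  ultimately show ?thesis using that[of "eval_fps G"] by blast
qed

lemma bigo_at_0_iff_fps:
  fixes f :: "real \<Rightarrow> real"
  assumes f: "f has_fps_expansion F"
  shows "f \<in> O[at 0](\<lambda>z. z ^ n) \<longleftrightarrow> (\<forall>m<n. fps_nth F m = 0)"
proof
  assume z: "\<forall>m<n. fps_nth F m = 0"
  obtain g where g: "isCont g 0" "eventually (\<lambda>z. f z = z ^ n * g z) (nhds 0)"
    using fps_expansion_factor[OF f z] by metis
  have ev: "eventually (\<lambda>z. f z = z ^ n * g z) (at 0)"
    using g(2) unfolding eventually_nhds_conv_at by blast
  have "(g \<longlongrightarrow> g 0) (at 0)" using g(1) by (simp add: isCont_def)
  moreover have "eventually (\<lambda>z::real. z ^ n \<noteq> 0) (at 0)"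
    unfolding eventually_at_filter by (intro always_eventually) simp
  then have "eventually (\<lambda>z. g z = f z / z ^ n) (at 0)"
    using ev by eventually_elim simp
  ultimately have "((\<lambda>z. f z / z ^ n) \<longlongrightarrow> g 0) (at 0)"
    by (simp cong: filterlim_cong add: tendsto_cong)
  then show "f \<in> O[at 0](\<lambda>z. z ^ n)"
    by (rule bigoI_tendsto) (unfold eventually_at_filter, intro always_eventually, simp)
next
  assume b: "f \<in> O[at 0](\<lambda>z. z ^ n)"
  show "\<forall>m<n. fps_nth F m = 0"
  proof (intro allI impI)
    fix m show "m < n \<Longrightarrow> fps_nth F m = 0"
    proof (induction m rule: less_induct)
      case (less m)
      then have z: "\<forall>k<m. fps_nth F k = 0" by auto
      obtain g where g: "isCont g 0" "g 0 = fps_nth F m"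
          "eventually (\<lambda>z. f z = z ^ m * g z) (nhds 0)"
        using fps_expansion_factor[OF f z] by metis
      have ev: "eventually (\<lambda>z. f z = z ^ m * g z) (at 0)"
        using g(3) unfolding eventually_nhds_conv_at by blast
      obtain C where C: "eventually (\<lambda>z. norm (f z) \<le> C * norm (z ^ n)) (at 0)"
        using b by (elim landau_o.bigE) auto
      have nz: "eventually (\<lambda>z::real. z \<noteq> 0) (at 0)" by (auto simp: eventually_at_filter)
      have "eventually (\<lambda>z. norm (g z) \<le> C * \<bar>z\<bar> ^ (n - m)) (at 0)"
        using ev C nz
      proof eventually_elim
        case (elim z)
        have "\<bar>z\<bar> ^ n = \<bar>z\<bar> ^ m * \<bar>z\<bar> ^ (n - m)"
          using less.prems by (simp flip: power_add)
        with elim have "\<bar>z\<bar> ^ m * \<bar>g z\<bar> \<le> \<bar>z\<bar> ^ m * (C * \<bar>z\<bar> ^ (n - m))"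
          by (simp add: abs_mult power_abs mult_ac)
        then show ?case using elim by simp
      qed
      moreover have "((\<lambda>z::real. C * \<bar>z\<bar> ^ (n - m)) \<longlongrightarrow> C * \<bar>0\<bar> ^ (n - m)) (at 0)"
        by (intro tendsto_intros)
      then have "((\<lambda>z::real. C * \<bar>z\<bar> ^ (n - m)) \<longlongrightarrow> 0) (at 0)"
        using less.prems by (simp add: power_0_left)
      ultimately have "(g \<longlongrightarrow> 0) (at 0)" by (rule Lim_null_comparison)
      moreover have "(g \<longlongrightarrow> g 0) (at 0)" using g(1) by (simp add: isCont_def)
      ultimately show ?case using g(2) LIM_unique by force
    qed
  qed
qed

lemma is_pade_exp_iff:
  "is_pade l m exp P Q \<longleftrightarrow> degree P \<le> l \<and> degree Q \<le> m \<and> coeff Q 0 = 1 \<and>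
    (\<forall>i<l+m+1. fps_nth (fps_of_poly Q * fps_exp 1) i = coeff P i)"
proof -
  have "(\<lambda>z. poly Q z * exp z - poly P z) has_fps_expansion
      (fps_of_poly Q * fps_exp 1 - fps_of_poly P)"
    by (intro fps_expansion_intros has_fps_expansion_poly)
  from bigo_at_0_iff_fps[OF this, of "l + m + 1"] show ?thesis
    unfolding is_pade_def by (simp only: poly_0_coeff_0 fps_sub_nth fps_of_poly_nth right_minus_eq)
qed


subsection \<open>The explicit denominator\<close>

lemma alternating_binomial_sum_poly:
  fixes p :: "real poly"
  assumes "degree p < n"
  shows "(\<Sum>k\<le>n. (-1) ^ k * real (n choose k) * poly p (real k)) = 0"
  using assms
proof (induction n arbitrary: p)
  case 0
  then show ?case by simp
next
  case (Suc n)
  define q where "q = p - pcompose p [:1, 1:]"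
  have *: "(\<Sum>k\<le>Suc n. (-1) ^ k * real (Suc n choose k) * poly p (real k))
      = (\<Sum>k\<le>n. (-1) ^ k * real (n choose k) * poly q (real k))"
  proof -
    have "(\<Sum>k\<le>Suc n. (-1) ^ k * real (Suc n choose k) * poly p (real k))
      = poly p 0 + (\<Sum>k\<le>n. (-1) ^ Suc k * real (Suc n choose Suc k) * poly p (real (Suc k)))"
      by (subst sum.atMost_Suc_shift) simp
    also have "\<dots> = poly p 0
        + (\<Sum>k\<le>n. (-1) ^ Suc k * real (n choose Suc k) * poly p (real (Suc k)))
        - (\<Sum>k\<le>n. (-1) ^ k * real (n choose k) * poly p (real (Suc k)))"
      by (simp add: algebra_simps sum.distrib sum_negf sum_subtractf)
    also have "poly p 0 + (\<Sum>k\<le>n. (-1) ^ Suc k * real (n choose Suc k) * poly p (real (Suc k)))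
        = (\<Sum>k\<le>Suc n. (-1) ^ k * real (n choose k) * poly p (real k))"
      by (simp add: sum.atMost_Suc_shift del: sum.atMost_Suc)
    also have "\<dots> = (\<Sum>k\<le>n. (-1) ^ k * real (n choose k) * poly p (real k))"
      by (simp add: binomial_eq_0)
    finally show ?thesis
      by (simp add: q_def poly_pcompose algebra_simps sum_subtractf)
  qed
  show ?case
  proof (cases "degree p = 0")
    case True
    then obtain a where "p = [:a:]" by (rule degree_eq_zeroE)
    then have "q = 0" by (simp add: q_def)
    then show ?thesis unfolding * by simp
  next
    case False
    have dc: "degree (pcompose p [:1, 1:]) = degree p" by (simp add: degree_pcompose)
    have "lead_coeff (pcompose p [:1, 1:]) = lead_coeff p"
      by (subst lead_coeff_comp) auto
    then have "coeff q (degree p) = 0" by (simp add: q_def dc)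
    moreover have "degree q \<le> degree p"
      unfolding q_def by (rule degree_diff_le) (simp_all add: dc)
    ultimately have "degree q < degree p"
      using False by (metis degree_0 eq_zero_or_degree_less gr0I)
    with Suc.prems have "degree q < n" by simp
    then show ?thesis unfolding * by (rule Suc.IH)
  qed
qed

definition pade_denom_explicit :: "nat \<Rightarrow> real poly"
  where "pade_denom_explicit s = (\<Sum>k\<le>s+1.
    monom (fact (2 * s-k) * fact (s+1) / (fact (2 * s) * fact k * fact (s+1-k)) * (-1) ^ k) k)"

lemma coeff_pade_denom_explicit:
  "coeff (pade_denom_explicit s) k =
    (if k \<le> s + 1 then fact (2 * s-k) * fact (s+1) / (fact (2 * s) * fact k * fact (s+1-k)) * (-1) ^ k
     else 0)"
  unfolding pade_denom_explicit_def coeff_sum coeff_monom by (subst sum.delta) auto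

lemma fact_quotient_poly:
  assumes "m \<le> n"
  obtains p :: "real poly" where "degree p \<le> n - m"
    "\<And>k. k \<le> n \<Longrightarrow> poly p (real k) = (if k \<le> m then fact (n - k) / fact (m - k) else 0)"
proof -
  define p :: "real poly" where "p = (\<Prod>i<n-m. [:real (n - i), -1:])"
  have "degree p \<le> (\<Sum>i<n-m. degree [:real (n - i), -1:])"
    unfolding p_def by (rule order.trans[OF degree_prod_sum_le]) auto
  then have 1: "degree p \<le> n - m" by simp
  have 2: "poly p (real k) = (if k \<le> m then fact (n - k) / fact (m - k) else 0)" if k: "k \<le> n" for k
  proof (cases "k \<le> m")
    case True
    have "(\<Prod>i<d. real (n - i) - real k) = fact (n - k) / fact (n - d - k)" if "d + k \<le> n" for d
      using that
    proof (induction d)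
      case (Suc d)
      then have e: "n - d - k = Suc (n - Suc d - k)" by simp
      have r: "real (n - d) - real k = real (n - d - k)" using Suc.prems by (simp add: of_nat_diff)
      have f: "fact (n - d - k) = (real (n - d - k) * fact (n - Suc d - k) :: real)"
        unfolding e by simp
      have nz: "real (n - d - k) \<noteq> 0" using e by simp
      have IH: "(\<Prod>i<d. real (n - i) - real k) = fact (n - k) / fact (n - d - k)"
        using Suc by simp
      have "(\<Prod>i<Suc d. real (n - i) - real k)
          = fact (n - k) / fact (n - d - k) * real (n - d - k)"
        unfolding prod.lessThan_Suc IH r ..
      also have "\<dots> = fact (n - k) / fact (n - Suc d - k)"
        unfolding f using nz by (simp only: divide_simps) simp
      finally show ?case .
    qed simp
    from this[of "n - m"] show ?thesis using True assms by (simp add: p_def poly_prod)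
  next
    case False
    then have "n - k \<in> {..<n-m}" "real (n - (n - k)) + - real k = 0" using k by auto
    then have "(\<Prod>i<n-m. real (n - i) - real k) = 0"
      by (intro prod_zero) auto
    then show ?thesis using False by (simp add: p_def poly_prod)
  qed
  from 1 2 that show ?thesis by blast
qed

lemma pade_denom_explicit_mult_exp_nth:
  assumes s: "s \<ge> 1" and m: "s \<le> m" "m \<le> 2 * s"
  shows "fps_nth (fps_of_poly (pade_denom_explicit s) * fps_exp 1) m = 0"
proof -
  obtain p :: "real poly" where p: "degree p \<le> 2 * s - m"
    "\<And>k. k \<le> 2 * s \<Longrightarrow> poly p (real k) = (if k \<le> m then fact (2 * s - k) / fact (m - k) else 0)"
    using fact_quotient_poly[OF m(2)] by blast
  define t where "t k = (if k \<le> m then coeff (pade_denom_explicit s) k / fact (m - k) else 0)" for k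
  have t: "t k = 1 / fact (2 * s) * ((-1) ^ k * real (s + 1 choose k) * poly p (real k))"
    if k: "k \<le> s + 1" for k
  proof -
    have "real (s + 1 choose k) = fact (s + 1) / (fact k * fact (s + 1 - k))"
      using k by (rule binomial_fact)
    moreover have "k \<le> 2 * s" using k s by simp
    ultimately show ?thesis
      using k by (simp add: t_def p(2) coeff_pade_denom_explicit mult_ac)
  qed
  have "fps_nth (fps_of_poly (pade_denom_explicit s) * fps_exp 1) m = (\<Sum>k\<le>m. t k)"
    by (simp add: fps_mult_nth t_def atLeast0AtMost)
  also have "\<dots> = (\<Sum>k\<le>max m (s+1). t k)"
    by (rule sum.mono_neutral_left) (auto simp: t_def)
  also have "\<dots> = (\<Sum>k\<le>s+1. t k)"
    by (rule sum.mono_neutral_right) (auto simp: t_def coeff_pade_denom_explicit)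
  also have "\<dots> = 1 / fact (2 * s) *
      (\<Sum>k\<le>s+1. (-1) ^ k * real (s + 1 choose k) * poly p (real k))"
    unfolding sum_distrib_left by (rule sum.cong[OF refl], rule t) simp
  also have "(\<Sum>k\<le>s+1. (-1) ^ k * real (s + 1 choose k) * poly p (real k)) = 0"
    by (rule alternating_binomial_sum_poly) (use p(1) m in simp)
  finally show ?thesis by simp
qed

lemma is_pade_explicit:
  assumes s: "s \<ge> 1"
  shows "\<exists>P. is_pade (s - 1) (s + 1) exp P (pade_denom_explicit s)"
proof
  let ?F = "fps_of_poly (pade_denom_explicit s) * fps_exp 1"
  show "is_pade (s - 1) (s + 1) exp (truncate_fps s ?F) (pade_denom_explicit s)"
    unfolding is_pade_exp_iff
  proof (intro conjI allI impI)
    show "degree (truncate_fps s ?F) \<le> s - 1"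
      using degree_truncate_fps[of s ?F] s by simp
    show "degree (pade_denom_explicit s) \<le> s + 1"
      by (rule degree_le) (simp add: coeff_pade_denom_explicit)
    show "coeff (pade_denom_explicit s) 0 = 1"
      by (simp add: coeff_pade_denom_explicit)
    fix i assume "i < s - 1 + (s + 1) + 1"
    then show "fps_nth ?F i = coeff (truncate_fps s ?F) i"
      using pade_denom_explicit_mult_exp_nth[OF s, of i] s by (simp add: coeff_truncate_fps)
  qed
qed

lemma pade_denom_unique:
  assumes s: "s \<ge> 1" and 1: "is_pade (s - 1) (s + 1) exp P Q"
    and 2: "is_pade (s - 1) (s + 1) exp P' Q'"
  shows "Q = Q'"
proof -
  define D where "D = Q - Q'"
  obtain a E where DE: "D = pCons a E" by (rule pCons_cases)
  have "coeff D 0 = 0" using 1 2 by (simp add: D_def is_pade_exp_iff)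
  then have a: "a = 0" by (simp add: DE)
  have dD: "degree D \<le> s + 1"
    using 1 2 unfolding D_def by (intro degree_diff_le) (auto simp: is_pade_exp_iff)
  have dE: "degree E \<le> s"
    using dD by (simp add: DE split: if_splits)
  have WD: "fps_nth (fps_of_poly D * fps_exp 1) i = 0" if i: "s \<le> i" "i \<le> 2 * s" for i
  proof -
    have "coeff P i = 0" "coeff P' i = 0"
      using 1 2 i s by (auto simp: is_pade_exp_iff intro!: coeff_eq_0)
    moreover have "i < s - 1 + (s + 1) + 1" using i s by simp
    ultimately show ?thesis using 1 2 unfolding is_pade_exp_iff D_def
      by (simp add: fps_of_poly_diff left_diff_distrib)
  qed
  have V: "fps_nth (fps_of_poly E * fps_exp 1) i = 0" if i: "s - 1 \<le> i" "i < 2 * s" for i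
  proof -
    have eq: "fps_of_poly D * fps_exp 1 = fps_X * (fps_of_poly E * fps_exp 1)"
      by (simp add: DE a fps_of_poly_pCons mult_ac)
    have "fps_nth (fps_of_poly D * fps_exp 1) (Suc i) = fps_nth (fps_of_poly E * fps_exp 1) i"
      unfolding eq by simp
    then show ?thesis using WD[of "Suc i"] i s by linarith
  qed
  define T where "T p = p + pderiv p" for p :: "real poly"
  have Tinj: "p = 0" if "T p = 0" for p
  proof (rule ccontr)
    assume "p \<noteq> 0"
    then have "coeff (T p) (degree p) \<noteq> 0"
      by (simp add: T_def coeff_pderiv coeff_eq_0)
    with that show False by simp
  qed
  have iter: "degree ((T ^^ k) E) \<le> s \<and>
      (\<forall>i. fps_nth (fps_of_poly ((T ^^ k) E) * fps_exp 1) i = 0 \<longleftrightarrow>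
           fps_nth (fps_of_poly E * fps_exp 1) (i + k) = 0)" for k
  proof (induction k)
    case 0
    then show ?case using dE by simp
  next
    case (Suc k)
    let ?p = "(T ^^ k) E"
    have eq: "fps_of_poly (T ?p) * fps_exp 1 = fps_deriv (fps_of_poly ?p * fps_exp 1)"
      by (simp add: T_def fps_of_poly_add fps_of_poly_pderiv algebra_simps)
    have "fps_nth (fps_of_poly (T ?p) * fps_exp 1) i
        = real (Suc i) * fps_nth (fps_of_poly ?p * fps_exp 1) (Suc i)" for i
      unfolding eq fps_deriv_nth by simp
    then have "fps_nth (fps_of_poly (T ?p) * fps_exp 1) i = 0 \<longleftrightarrow>
        fps_nth (fps_of_poly E * fps_exp 1) (i + Suc k) = 0" for i
      using Suc by (simp del: of_nat_Suc)
    moreover have "degree (T ?p) \<le> s"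
      unfolding T_def[of ?p] using Suc by (intro degree_add_le) (auto simp: degree_pderiv)
    ultimately show ?case using Suc by auto
  qed
  define p where "p = (T ^^ (s - 1)) E"
  have "fps_nth (fps_of_poly p * fps_exp 1) i = 0" if "i \<le> s" for i
    using iter[of "s - 1"] V[of "i + (s - 1)"] that s by (simp add: p_def)
  then have "fps_nth ((fps_of_poly p * fps_exp 1) * fps_exp (-1)) i = 0" if "i \<le> s" for i
    unfolding fps_mult_nth[of "fps_of_poly p * fps_exp 1"] using that
    by (intro sum.neutral) auto
  moreover have "(fps_of_poly p * fps_exp 1) * fps_exp (-1) = fps_of_poly p"
    using fps_exp_add_mult[of "1::real" "-1"] by (simp add: mult.assoc)
  ultimately have "coeff p i = 0" if "i \<le> s" for i using that by simp
  moreover have "coeff p i = 0" if "i > s" for i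
    using iter[of "s - 1"] that by (auto simp: p_def intro!: coeff_eq_0)
  ultimately have "p = 0" by (intro poly_eqI) (metis coeff_0 not_le)
  moreover have "E = 0" if "(T ^^ k) E = 0" for k
    using that by (induction k) (auto dest: Tinj)
  ultimately have "E = 0" by (simp add: p_def)
  then show ?thesis using DE a D_def by simp
qed

theorem pade_denom_exp_eq:
  assumes "s \<ge> 1"
  shows "pade_denom_exp s = pade_denom_explicit s"
  unfolding pade_denom_exp_def
  using is_pade_explicit[OF assms] pade_denom_unique[OF assms] by (intro the_equality) blast+

end

theory Submission
  imports Defs
begin

text \<open>The coefficients of \<open>Q\<^sub>s(z) e\<^sup>x\<^sup>z\<close> are polynomials \<open>p\<^sub>m(x)\<close> with \<open>p\<^sub>m' = p\<^sub>m\<^sub>-\<^sub>1\<close>, so the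
  coefficients of \<open>z\<^sup>0, \<dots>, z\<^sup>2\<^sup>s\<close> in a linear relation \<open>\<Sum>\<^sub>j (a\<^sub>j + b\<^sub>j z) \<Pi>\<^sub>j = 0\<close> say that the
  functional \<open>L f = \<Sum>\<^sub>j a\<^sub>j f(c\<^sub>j) + b\<^sub>j f'(c\<^sub>j)\<close> kills all polynomials of degree at most \<open>2s\<close>. Such a
  functional is a multiple \<open>\<lambda>\<close> of the divided difference with all nodes doubled, and so
  \<open>b\<^sub>j = \<lambda> / w\<^sub>j\<^sup>2\<close> with \<open>w\<^sub>j = \<Prod>\<^sub>i\<^sub>\<noteq>\<^sub>j (c\<^sub>j - c\<^sub>i)\<close>. The remaining coefficient, that of \<open>z\<^sup>2\<^sup>s\<^sup>+\<^sup>1\<close>, gives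
  \<open>\<lambda> \<Sum>\<^sub>j p\<^sub>2\<^sub>s(c\<^sub>j) / w\<^sub>j\<^sup>2 = 0\<close>. Since \<open>p\<^sub>2\<^sub>s(x) = x\<^sup>s\<^sup>-\<^sup>1 (x - 1)\<^sup>s\<^sup>+\<^sup>1 / (2s)!\<close> has constant sign on \<open>[0, 1]\<close>
  and does not vanish at \<open>c\<^sub>s\<^sub>-\<^sub>1\<close>, this forces \<open>\<lambda> = 0\<close>.\<close>

section \<open>Coefficients of \<open>Q(z) e^(xz)\<close> as Appell polynomials in
  \<open>x\<close>\<close>

definition appell_poly :: "real poly \<Rightarrow> nat \<Rightarrow> real poly"
  where "appell_poly Q m = (\<Sum>k\<le>m. monom (coeff Q k / fact (m - k)) (m - k))"

lemma poly_appell_poly: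
  "poly (appell_poly Q m) x = fps_nth (fps_of_poly Q * fps_exp x) m"
  by (simp add: appell_poly_def poly_sum poly_monom fps_mult_nth atLeast0AtMost)

lemma degree_appell_poly: "degree (appell_poly Q m) \<le> m"
  unfolding appell_poly_def
  by (intro degree_sum_le) (auto intro: order.trans[OF degree_monom_le])

lemma coeff_appell_poly: "coeff (appell_poly Q m) m = coeff Q 0 / fact m"
proof -
  have "coeff (appell_poly Q m) m = (\<Sum>k\<le>m. if k = 0 then coeff Q 0 / fact m else 0)"
    unfolding appell_poly_def coeff_sum by (intro sum.cong) auto
  then show ?thesis by simp
qed

lemma pderiv_appell_poly_0: "pderiv (appell_poly Q 0) = 0"
  by (simp add: appell_poly_def pderiv_monom)

lemma pderiv_sum: "pderiv (\<Sum>i\<in>A. f i) = (\<Sum>i\<in>A. pderiv (f i))"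
  by (induction A rule: infinite_finite_induct) (simp_all add: pderiv_add)

text \<open>Differentiating \<open>Q(z) e^(xz)\<close> in \<open>x\<close> multiplies it by
  \<open>z\<close>. This is what turns the terms with \<open>z\<close> in a relation into
  derivatives at the nodes.\<close>

lemma pderiv_appell_poly_Suc: "pderiv (appell_poly Q (Suc m)) = appell_poly Q m"
proof -
  have "pderiv (appell_poly Q (Suc m))
      = (\<Sum>k\<le>m. pderiv (monom (coeff Q k / fact (Suc m - k)) (Suc m - k)))"
    by (simp add: appell_poly_def pderiv_sum pderiv_monom pderiv_add)
  also have "\<dots> = appell_poly Q m"
    unfolding appell_poly_def
    by (intro sum.cong) (simp_all add: pderiv_monom Suc_diff_le del: of_nat_Suc)
  finally show ?thesis .
qed

text \<open>For \<open>m = 2 * s\<close> the factor \<open>fact (2 * s - k)\<close> in the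
  denominator coefficients cancels, leaving the binomial expansion of
  \<open>(x - 1) ^ (s + 1)\<close> times \<open>x ^ (s - 1)\<close>.\<close>

lemma appell_poly_pade:
  assumes s: "s \<ge> 1"
  shows "poly (appell_poly (pade_denom_exp s) (2 * s)) x = x ^ (s - 1) * (x - 1) ^ (s + 1) / fact (2 * s)"
proof -
  have "poly (appell_poly (pade_denom_exp s) (2 * s)) x
      = (\<Sum>k\<le>2 * s. coeff (pade_denom_explicit s) k / fact (2 * s - k) * x ^ (2 * s - k))"
    by (simp add: appell_poly_def poly_sum poly_monom pade_denom_exp_eq[OF s])
  also have "\<dots> = (\<Sum>k\<le>s+1. coeff (pade_denom_explicit s) k / fact (2 * s - k) * x ^ (2 * s - k))"
    by (rule sum.mono_neutral_right) (use s in \<open>auto simp: coeff_pade_denom_explicit\<close>)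
  also have "\<dots> = (\<Sum>k\<le>s+1. x ^ (s - 1) / fact (2 * s)
      * (real (s + 1 choose k) * (- 1) ^ k * x ^ (s + 1 - k)))"
  proof (rule sum.cong)
    fix k assume "k \<in> {..s+1}"
    then have k: "k \<le> s + 1" by simp
    have "2 * s - k = (s - 1) + (s + 1 - k)" using k s by simp
    then have "x ^ (2 * s - k) = x ^ (s - 1) * x ^ (s + 1 - k)" by (simp only: power_add)
    then show "coeff (pade_denom_explicit s) k / fact (2 * s - k) * x ^ (2 * s - k)
        = x ^ (s - 1) / fact (2 * s) * (real (s + 1 choose k) * (- 1) ^ k * x ^ (s + 1 - k))"
      using k by (simp add: coeff_pade_denom_explicit binomial_fact field_simps del: fact_Suc)
  qed simp
  also have "\<dots> = x ^ (s - 1) / fact (2 * s) * (- 1 + x) ^ (s + 1)"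
    by (simp only: binomial_ring sum_distrib_left)
  finally show ?thesis by simp
qed

section \<open>Functionals in values and first derivatives at nodes\<close>

definition hermite_functional ::
    "nat set \<Rightarrow> (nat \<Rightarrow> real) \<Rightarrow> (nat \<Rightarrow> real) \<Rightarrow> (nat \<Rightarrow> real) \<Rightarrow> real poly \<Rightarrow> real"
  where "hermite_functional I c a b f =
    (\<Sum>j\<in>I. a j * poly f (c j) + b j * poly (pderiv f) (c j))"

lemma hermite_functional_smult:
  "hermite_functional I c a b (smult r f) = r * hermite_functional I c a b f"
  unfolding hermite_functional_def sum_distrib_left
  by (intro sum.cong) (simp_all add: pderiv_smult algebra_simps)

lemma hermite_functional_diff:
  "hermite_functional I c a b (f - g) = hermite_functional I c a b f - hermite_functional I c a b g"
  by (simp add: hermite_functional_def pderiv_diff sum_subtractf algebra_simps sum.distrib)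

lemma hermite_functional_top:
  assumes 0: "\<And>f. degree f \<le> n \<Longrightarrow> hermite_functional I c a b f = 0"
    and f: "degree f \<le> Suc n"
  shows "hermite_functional I c a b f = coeff f (Suc n) * hermite_functional I c a b (monom 1 (Suc n))"
proof -
  let ?g = "f - smult (coeff f (Suc n)) (monom 1 (Suc n))"
  have "degree ?g \<le> n"
    using f by (intro degree_le) (auto simp: coeff_eq_0)
  from 0[OF this] show ?thesis
    by (simp add: hermite_functional_diff hermite_functional_smult)
qed

text \<open>Since \<open>p m\<close> has degree exactly \<open>m\<close>, leading terms can be
  removed one after another, so \<open>p 0, ..., p n\<close> generate all polynomials of degree at
  most \<open>n\<close>.\<close>

lemma hermite_functional_eq_0:
  assumes p: "\<And>m. m \<le> n \<Longrightarrow> degree (p m) \<le> m" "\<And>m. m \<le> n \<Longrightarrow> coeff (p m) m \<noteq> 0"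
    and 0: "\<And>m. m \<le> n \<Longrightarrow> hermite_functional I c a b (p m) = 0"
    and f: "degree f \<le> n"
  shows "hermite_functional I c a b f = 0"
proof -
  have "degree f \<le> k \<Longrightarrow> k \<le> n \<Longrightarrow> hermite_functional I c a b f = 0" for k f
  proof (induction k arbitrary: f rule: less_induct)
    case (less k)
    define g where "g = f - smult (coeff f k / coeff (p k) k) (p k)"
    have ck: "coeff g k = 0" using p(2)[of k] less.prems by (simp add: g_def)
    have dk: "degree g \<le> k"
      unfolding g_def using p(1)[of k] less.prems by (intro degree_diff_le) auto
    have "hermite_functional I c a b g = 0"
    \<comment> \<open>The degree can fail to drop only for \<open>k = 0\<close>, and then
      \<open>g = 0\<close>.\<close>
    proof (cases "degree g < k")
      case True
      then show ?thesis using less.IH[of "degree g" g] less.prems by simp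
    next
      case False
      then have "degree g = k" using dk by simp
      then have "g = 0" using ck by auto
      then show ?thesis by (simp add: hermite_functional_def)
    qed
    then show ?case
      using 0[of k] less.prems by (simp add: g_def hermite_functional_diff hermite_functional_smult)
  qed
  then show ?thesis using f by blast
qed

section \<open>Squared node polynomials as test functions\<close>

definition node_poly :: "nat set \<Rightarrow> (nat \<Rightarrow> real) \<Rightarrow> nat \<Rightarrow> real poly"
  where "node_poly I c j = (\<Prod>i\<in>I - {j}. [:- c i, 1:])"

lemma poly_node_poly_eq_0_iff:
  assumes "finite I"
  shows "poly (node_poly I c j) x = 0 \<longleftrightarrow> (\<exists>i\<in>I - {j}. x = c i)"
  using assms by (auto simp: node_poly_def poly_prod)

lemma degree_node_poly:
  assumes "finite I" "j \<in> I"
  shows "degree (node_poly I c j) = card I - 1"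
  using assms by (simp add: node_poly_def degree_prod_eq_sum_degree)

lemma lead_coeff_node_poly: "lead_coeff (node_poly I c j) = 1"
  by (simp add: node_poly_def lead_coeff_prod)

context
  fixes I :: "nat set" and c :: "nat \<Rightarrow> real" and a b :: "nat \<Rightarrow> real" and j :: nat
  assumes I: "finite I" "inj_on c I" and j: "j \<in> I"
begin

lemma poly_node_poly_other:
  assumes "i \<in> I" "i \<noteq> j"
  shows "poly (node_poly I c j) (c i) = 0"
  using assms I by (auto simp: poly_node_poly_eq_0_iff)

text \<open>The square has a double zero at every node other than \<open>c j\<close>, so only the
  summand of \<open>j\<close> survives; the product rule expands it.\<close>

lemma hermite_functional_node_poly_sq:
  "hermite_functional I c a b (node_poly I c j ^ 2 * g) =
    (a j * poly g (c j) + b j * poly (pderiv g) (c j)) * poly (node_poly I c j) (c j) ^ 2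
    + b j * poly (pderiv (node_poly I c j ^ 2)) (c j) * poly g (c j)"
proof -
  let ?w = "node_poly I c j"
  let ?t = "\<lambda>i. a i * poly (?w ^ 2 * g) (c i) + b i * poly (pderiv (?w ^ 2 * g)) (c i)"
  have "?t i = 0" if "i \<in> I - {j}" for i
    using poly_node_poly_other[of i] that
    by (simp add: power2_eq_square pderiv_mult)
  then have "hermite_functional I c a b (?w ^ 2 * g) = ?t j"
    unfolding hermite_functional_def using I(1) j by (simp add: sum.remove[OF I(1) j])
  then show ?thesis by (simp add: pderiv_mult algebra_simps)
qed

text \<open>The test polynomial is the Hermite basis polynomial of the derivative at \<open>c\<^sub>j\<close>, up to scaling.\<close>

lemma hermite_functional_derivative_weight:
  assumes card: "card I = Suc s"
    and 0: "\<And>f. degree f \<le> 2 * s \<Longrightarrow> hermite_functional I c a b f = 0"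
  shows "b j * poly (node_poly I c j) (c j) ^ 2 = hermite_functional I c a b (monom 1 (Suc (2 * s)))"
proof -
  let ?w = "node_poly I c j"
  let ?h = "?w ^ 2 * [:- c j, 1:]"
  have w0: "?w \<noteq> 0" using lead_coeff_node_poly[of I c j] by auto
  have d: "degree ?h = Suc (2 * s)"
    using w0 degree_node_poly[OF I(1) j, of c] card
    by (simp add: degree_mult_eq degree_power_eq del: mult_pCons_right)
  have "lead_coeff ?h = 1"
    by (simp add: lead_coeff_mult lead_coeff_power lead_coeff_node_poly del: mult_pCons_right)
  then have "hermite_functional I c a b ?h = hermite_functional I c a b (monom 1 (Suc (2 * s)))"
    using hermite_functional_top[OF 0, of "2 * s" ?h] d by simp
  then show ?thesis
    unfolding hermite_functional_node_poly_sq by (simp add: pderiv_pCons)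
qed

text \<open>The square itself has degree \<open>2 * s\<close>, so it is killed; with
  \<open>b j = 0\<close> only \<open>a j\<close> times its nonzero value at \<open>c j\<close>
  remains.\<close>

lemma hermite_functional_value_weight:
  assumes card: "card I = Suc s" and b: "b j = 0"
    and 0: "\<And>f. degree f \<le> 2 * s \<Longrightarrow> hermite_functional I c a b f = 0"
  shows "a j = 0"
proof -
  let ?w = "node_poly I c j"
  have w0: "?w \<noteq> 0" using lead_coeff_node_poly[of I c j] by auto
  have "degree (?w ^ 2 * 1) \<le> 2 * s"
    using w0 degree_node_poly[OF I(1) j, of c] card by (simp add: degree_power_eq)
  then have "a j * poly ?w (c j) ^ 2 = 0"
    using 0 hermite_functional_node_poly_sq[of 1] b by simp
  moreover have "poly ?w (c j) \<noteq> 0"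
    using I j by (auto simp: poly_node_poly_eq_0_iff inj_on_def)
  ultimately show ?thesis by simp
qed

end

section \<open>Linear relations among the truncations\<close>

lemma coeff_taylor_truncation:
  "coeff (taylor_truncation N f) m = (if m \<le> N then fps_nth f m else 0)"
  unfolding taylor_truncation_def coeff_sum coeff_monom by (subst sum.delta) auto

lemma coeff_Pi_poly:
  "coeff (Pi_poly s x) m = (if m \<le> 2 * s then poly (appell_poly (pade_denom_exp s) m) x else 0)"
  by (simp add: Pi_poly_def coeff_taylor_truncation poly_appell_poly)

lemma degree_Pi_poly: "degree (Pi_poly s x) \<le> 2 * s"
  by (rule degree_le) (simp add: coeff_Pi_poly)

lemma appell_pade_node_sum_nonzero:
  fixes c v :: "nat \<Rightarrow> real"
  assumes s: "s \<ge> 1" and c0: "c 0 = 0" and cs: "c s = 1" and mono: "strict_mono_on {..s} c"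
    and v: "\<And>j. j \<le> s \<Longrightarrow> v j > 0"
  shows "(\<Sum>j\<le>s. v j * poly (appell_poly (pade_denom_exp s) (2 * s)) (c j)) \<noteq> 0"
proof -
  let ?p = "\<lambda>j. v j * (c j ^ (s - 1) * (1 - c j) ^ (s + 1) / fact (2 * s))"
  have c: "0 \<le> c j" "c j \<le> 1" if "j \<le> s" for j
    using strict_mono_on_leD[OF mono, of 0 j] strict_mono_on_leD[OF mono, of j s] that c0 cs by auto
  \<comment> \<open>At \<open>c s = 1\<close> the summand vanishes, so the last node before it
    supplies strict positivity.\<close>
  have "c (s - 1) < 1" using strict_mono_onD[OF mono, of "s - 1" s] s cs by simp
  moreover have "c (s - 1) ^ (s - 1) > 0"
  \<comment> \<open>For \<open>s = 1\<close> this node is \<open>0\<close>, but the exponent is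
    \<open>0\<close> too and the power is \<open>1\<close>.\<close>
  proof (cases "s = 1")
    case False
    then have "c 0 < c (s - 1)" using strict_mono_onD[OF mono, of 0 "s - 1"] s by simp
    then show ?thesis using c0 by simp
  qed simp
  ultimately have "?p (s - 1) > 0"
    using v[of "s - 1"] by simp
  moreover have "?p j \<ge> 0" if "j \<le> s" for j
    using c[OF that] v[OF that] by simp
  ultimately have "(\<Sum>j\<le>s. ?p j) > 0"
    by (intro sum_pos2[of _ "s - 1"]) auto
  moreover have "(\<Sum>j\<le>s. v j * poly (appell_poly (pade_denom_exp s) (2 * s)) (c j))
      = (- 1) ^ (s + 1) * (\<Sum>j\<le>s. ?p j)"
    unfolding sum_distrib_left
  proof (rule sum.cong)
    fix j
    have "(c j - 1) ^ (s + 1) = (- 1) ^ (s + 1) * (1 - c j) ^ (s + 1)"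
      by (simp only: flip: power_mult_distrib) simp
    then show "v j * poly (appell_poly (pade_denom_exp s) (2 * s)) (c j) = (- 1) ^ (s + 1) * ?p j"
      unfolding appell_poly_pade[OF s] by (simp only: ac_simps times_divide_eq_right)
  qed simp
  ultimately show ?thesis by simp
qed

lemma Pi_poly_relation_trivial:
  fixes c a b :: "nat \<Rightarrow> real"
  assumes s: "s \<ge> 1" and c0: "c 0 = 0" and cs: "c s = 1" and mono: "strict_mono_on {..s} c"
    and rel: "(\<Sum>j\<le>s. smult (a j) (Pi_poly s (c j)) + smult (b j) ([:0, 1:] * Pi_poly s (c j))) = 0"
    and j: "j \<le> s"
  shows "a j = 0 \<and> b j = 0"
proof -
  define p where "p = appell_poly (pade_denom_exp s)"
  let ?L = "hermite_functional {..s} c a b"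
  let ?w = "\<lambda>j. poly (node_poly {..s} c j) (c j) ^ 2"
  have inj: "inj_on c {..s}" using mono by (rule strict_mono_on_imp_inj_on)
  have rel_coeff: "(\<Sum>j\<le>s. a j * coeff (Pi_poly s (c j)) m
      + b j * coeff (pCons 0 (Pi_poly s (c j))) m) = 0" for m
    using arg_cong[OF rel, of "\<lambda>q. coeff q m"]
    by (simp add: coeff_sum del: smult_pCons flip: coeff_smult)
  \<comment> \<open>The factor \<open>z\<close> shifts coefficients by one, so \<open>b j\<close>
    meets \<open>p (m - 1)\<close>, the derivative of \<open>p m\<close>; for \<open>m = 0\<close>
    both the shifted coefficient and the derivative are \<open>0\<close>.\<close>
  have Lp: "?L (p m) = 0" if m: "m \<le> 2 * s" for m
  proof (cases m)
    case 0
    then show ?thesis using rel_coeff[of 0]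
      by (simp add: hermite_functional_def p_def coeff_Pi_poly pderiv_appell_poly_0)
  next
    case (Suc k)
    then show ?thesis using rel_coeff[of m] m
      by (simp add: hermite_functional_def p_def coeff_Pi_poly pderiv_appell_poly_Suc)
  qed
  have "coeff (pade_denom_exp s) 0 = 1"
    by (simp add: pade_denom_exp_eq[OF s] coeff_pade_denom_explicit)
  then have L0: "?L f = 0" if "degree f \<le> 2 * s" for f
    using hermite_functional_eq_0[of "2 * s" p, OF _ _ Lp that]
    by (simp add: p_def degree_appell_poly coeff_appell_poly)
  define l where "l = ?L (monom 1 (Suc (2 * s)))"
  have w: "?w j > 0" if "j \<le> s" for j
    using inj that by (auto simp: poly_node_poly_eq_0_iff inj_on_def)
  have bl: "b j = l * (1 / ?w j)" if "j \<le> s" for j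
    using hermite_functional_derivative_weight[OF _ inj _ _ L0, of j] w[OF that] that
    by (simp add: l_def field_simps)
  \<comment> \<open>In degree \<open>2 * s + 1\<close> the truncations contribute nothing, and only
    the shifted terms remain.\<close>
  have "0 = (\<Sum>j\<le>s. b j * poly (p (2 * s)) (c j))"
    using rel_coeff[of "Suc (2 * s)"] by (simp add: coeff_Pi_poly p_def)
  also have "\<dots> = l * (\<Sum>j\<le>s. (1 / ?w j) * poly (p (2 * s)) (c j))"
    unfolding sum_distrib_left by (intro sum.cong) (simp_all add: bl)
  finally have "l = 0"
    using appell_pade_node_sum_nonzero[OF s c0 cs mono, of "\<lambda>j. 1 / ?w j"] w by (simp add: p_def)
  then have "b j = 0" using bl[OF j] by simp
  moreover from this have "a j = 0"
    using hermite_functional_value_weight[OF _ inj _ _ _ L0] j by simp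
  ultimately show ?thesis by simp
qed

section \<open>From trivial relations to a basis\<close>

lemma (in vector_space) independent_image_family:
  assumes fin: "finite I"
    and triv: "\<And>u i. (\<Sum>i\<in>I. scale (u i) (f i)) = 0 \<Longrightarrow> i \<in> I \<Longrightarrow> u i = 0"
  shows "inj_on f I \<and> independent (f ` I)"
proof
  show inj: "inj_on f I"
  proof (rule inj_onI, rule ccontr)
    fix x y assume xy: "x \<in> I" "y \<in> I" "f x = f y" "x \<noteq> y"
    \<comment> \<open>If two indices shared a vector, the difference of their indicators would be a
      nontrivial relation.\<close>
    define u where "u i = (if i = x then 1 else 0) - (if i = y then 1 else 0 :: 'a)" for i
    have "(\<Sum>i\<in>I. scale (u i) (f i)) = (\<Sum>i\<in>I. (if i = x then f i else 0) - (if i = y then f i else 0))"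
      by (intro sum.cong) (auto simp: u_def)
    also have "\<dots> = 0" using fin xy by (simp add: sum_subtractf)
    finally show False using triv[of u x] xy by (simp add: u_def)
  qed
  show "independent (f ` I)"
  proof (rule independent_if_scalars_zero)
    fix u x assume "(\<Sum>x\<in>f ` I. scale (u x) x) = 0" "x \<in> f ` I"
    then show "u x = 0" using triv[of "\<lambda>i. u (f i)"] inj by (auto simp: sum.reindex)
  qed (use fin in simp)
qed

text \<open>A vector of \<open>span T\<close> outside \<open>span B\<close> would extend
  \<open>B\<close> to an independent subset of \<open>span T\<close> with more than
  \<open>card T\<close> elements.\<close>

lemma (in vector_space) span_eq_if_card_eq:
  assumes ind: "independent B" and sub: "B \<subseteq> span T" and T: "finite T" "card T \<le> card B"
  shows "span B = span T"
proof
  show "span B \<subseteq> span T" using sub span_minimal[OF _ subspace_span] by blast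
  show "span T \<subseteq> span B"
  proof (rule subsetI, rule ccontr)
    fix x assume x: "x \<in> span T" "x \<notin> span B"
    then have "independent (insert x B)" using ind by (simp add: independent_insertI)
    from independent_span_bound[OF T(1) this] x sub
    have "finite (insert x B)" "card (insert x B) \<le> card T" by auto
    moreover have "x \<notin> B" using x span_base by blast
    ultimately show False using T by simp
  qed
qed

lemma polys_upto_eq_span: "polys_upto N = poly_vs.span ((\<lambda>m. monom 1 m) ` {..N})"
proof
  show "polys_upto N \<subseteq> poly_vs.span ((\<lambda>m. monom 1 m) ` {..N})"
  proof
    fix p :: "real poly" assume "p \<in> polys_upto N"
    then have "p = (\<Sum>m\<le>N. smult (coeff p m) (monom 1 m))"
      using poly_as_sum_of_monoms'[of p N] by (simp add: polys_upto_def smult_monom)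
    also have "\<dots> \<in> poly_vs.span ((\<lambda>m. monom 1 m) ` {..N})"
      by (intro poly_vs.span_sum poly_vs.span_scale poly_vs.span_base) auto
    finally show "p \<in> poly_vs.span ((\<lambda>m. monom 1 m) ` {..N})" .
  qed
  have "poly_vs.subspace (polys_upto N)"
    by (rule poly_vs.subspaceI) (auto simp: polys_upto_def intro: degree_add_le)
  then show "poly_vs.span ((\<lambda>m. monom 1 m) ` {..N}) \<subseteq> polys_upto N"
    by (intro poly_vs.span_minimal) (auto simp: polys_upto_def degree_monom_eq)
qed

theorem theorem5p2:
  fixes s :: nat and c :: "nat \<Rightarrow> real"
  assumes "s \<ge> 1"
    and "c 0 = 0" and "c s = 1" and "\<forall>j<s. c j < c (Suc j)"
  shows "let B = (\<lambda>j. Pi_poly s (c j)) ` {0..s} \<union> (\<lambda>j. [:0, 1:] * Pi_poly s (c j)) ` {0..s}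
    in card B = 2 * s + 2 \<and> poly_vs.independent B \<and> poly_vs.span B = polys_upto (2 * s + 1)"
proof -
  define B where "B = (\<lambda>j. Pi_poly s (c j)) ` {0..s} \<union> (\<lambda>j. [:0, 1:] * Pi_poly s (c j)) ` {0..s}"
  \<comment> \<open>The boolean marks the factor \<open>z\<close>, merging both halves of
    \<open>B\<close> into one family with \<open>2 * (s + 1)\<close> indices; its injectivity gives
    the cardinality.\<close>
  define I where "I = (UNIV :: bool set) \<times> {..s}"
  define f where "f = (\<lambda>(t, j). if t then [:0, 1:] * Pi_poly s (c j) else Pi_poly s (c j))"
  have "c i < c j" if "i < j" "j \<le> s" for i j
    using that(2,1)
  proof (induction j)
    case (Suc j)
    then have "c j < c (Suc j)" "i = j \<or> c i < c j" using assms(4) less_Suc_eq by auto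
    then show ?case by auto
  qed simp
  then have mono: "strict_mono_on {..s} c" by (auto intro!: strict_mono_onI)
  have sum_I: "(\<Sum>i\<in>I. g i) = (\<Sum>j\<le>s. g (False, j) + g (True, j))" for g :: "bool \<times> nat \<Rightarrow> real poly"
    unfolding I_def by (simp add: sum.cartesian_product' UNIV_bool sum.distrib)
  have "inj_on f I \<and> poly_vs.independent (f ` I)"
  proof (rule poly_vs.independent_image_family)
    fix u i assume u: "(\<Sum>i\<in>I. smult (u i) (f i)) = 0" and i: "i \<in> I"
    have "u (False, j) = 0 \<and> u (True, j) = 0" if "j \<le> s" for j
      by (rule Pi_poly_relation_trivial[OF assms(1-3) mono _ that])
        (use u in \<open>simp add: sum_I f_def\<close>)
    with i show "u i = 0" by (cases i; cases "fst i") (auto simp: I_def)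
  qed (simp add: I_def)
  moreover have "f ` I = B"
    by (force simp: f_def I_def B_def image_iff split: if_splits)
  ultimately have ind: "poly_vs.independent B" and card: "card B = 2 * s + 2"
    using card_image[of f I] by (simp_all add: I_def card_cartesian_product)
  have "degree (Pi_poly s (c j)) \<le> 2 * s + 1" "degree ([:0, 1:] * Pi_poly s (c j)) \<le> 2 * s + 1" for j
    using degree_Pi_poly[of s "c j"] by (auto simp: degree_pCons_eq_if)
  then have "B \<subseteq> polys_upto (2 * s + 1)" unfolding B_def polys_upto_def by auto
  moreover have "card ((\<lambda>m. monom (1 :: real) m) ` {..2 * s + 1}) \<le> card B"
    using card_image_le[of "{..2 * s + 1}" "\<lambda>m. monom (1 :: real) m"] card by simp
  ultimately have "poly_vs.span B = polys_upto (2 * s + 1)"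
    unfolding polys_upto_eq_span by (intro poly_vs.span_eq_if_card_eq[OF ind]) auto
  with ind card show ?thesis by (simp add: B_def Let_def)
qed

end
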